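(* Let $p\geq 3$ be an integer and let $G$ be a finite simple $pK_2$-free graph with $\omega(G)=3$. Then $\chi(G)\leq 2p^2-3p+4$.
   Context: $\chi(G)$ is the chromatic number and $\omega(G)$ the clique number of $G$. $pK_2$ denotes the disjoint union of $p$ edges; $G$ is $pK_2$-free if it has no induced subgraph isomorphic to $pK_2$. *)

theory Defs
  imports "Graph_Theory.Graph_Theory"
begin

text \<open>
  A finite simple graph is modelled by the locale \<^locale>\<open>graph\<close>: a finite, loop-free, symmetric
  digraph without parallel arcs, an undirected edge being a pair of opposite arcs.
\<close>

text \<open>The vertices of the \<open>i\<close>-th edge of \<open>pK\<^sub>2\<close> are \<open>(i, False)\<close> and \<open>(i, True)\<close>.\<close>

definition pK2 :: "nat \<Rightarrow> (nat \<times> bool, (nat \<times> bool) \<times> (nat \<times> bool)) pre_digraph" where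
  "pK2 p = with_proj \<lparr> pverts = {..<p} \<times> UNIV,
     parcs = {((i, a), (i, b)) | i a b. i < p \<and> a \<noteq> b} \<rparr>"

definition pK2_free :: "nat \<Rightarrow> ('a, 'b) pre_digraph \<Rightarrow> bool" where
  "pK2_free p G \<longleftrightarrow> \<not> (\<exists>H. induced_subgraph H G \<and> digraph_iso H (pK2 p))"

definition is_clique :: "('a, 'b) pre_digraph \<Rightarrow> 'a set \<Rightarrow> bool" where
  "is_clique G C \<longleftrightarrow> C \<subseteq> verts G \<and> (\<forall>u\<in>C. \<forall>v\<in>C. u \<noteq> v \<longrightarrow> u \<rightarrow>\<^bsub>G\<^esub> v)"

definition clique_number :: "('a, 'b) pre_digraph \<Rightarrow> nat" where
  "clique_number G = Max {card C | C. is_clique G C}"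

definition proper_coloring :: "('a, 'b) pre_digraph \<Rightarrow> nat \<Rightarrow> ('a \<Rightarrow> nat) \<Rightarrow> bool" where
  "proper_coloring G k c \<longleftrightarrow>
     (\<forall>v\<in>verts G. c v < k) \<and> (\<forall>u\<in>verts G. \<forall>v\<in>verts G. u \<rightarrow>\<^bsub>G\<^esub> v \<longrightarrow> c u \<noteq> c v)"

definition chromatic_number :: "('a, 'b) pre_digraph \<Rightarrow> nat" where
  "chromatic_number G = (LEAST k. \<exists>c. proper_coloring G k c)"

end

theory Submission
  imports Defs
begin

text \<open>
  Let \<open>f p\<close> and \<open>g p\<close> be the largest chromatic numbers of \<open>pK\<^sub>2\<close>-free graphs without \<open>K\<^sub>4\<close> and
  without \<open>K\<^sub>3\<close>. In the triangle-free case the neighbourhoods of the ends of an edge are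
  independent, and what is anticomplete to the edge is \<open>(p - 1)K\<^sub>2\<close>-free, so
  \<open>g p \<le> g (p - 1) + 2\<close>. If \<open>a b c\<close> is a triangle of a \<open>K\<^sub>4\<close>-free graph, then the neighbours of \<open>a\<close>
  need at most \<open>g p\<close> colours, the vertices adjacent to \<open>b\<close> only among \<open>a, b, c\<close> need
  \<open>g (p - 1)\<close> because they miss the edge \<open>a c\<close>, the common neighbours of \<open>b\<close> and \<open>c\<close> outside the
  neighbourhood of \<open>a\<close> are independent, and the rest misses the edge \<open>a b\<close>; hence
  \<open>f p \<le> g p + g (p - 1) + 1 + f (p - 1)\<close>. With \<open>g 2 \<le> 3\<close>, \<open>g 3 \<le> 4\<close> and \<open>f 2 \<le> 5\<close> this gives
  \<open>f 3 \<le> 13\<close> and then \<open>f p \<le> f (p - 1) + 4 p - 5\<close>.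

  The two bounds \<open>g 3 \<le> 4\<close> and \<open>f 2 \<le> 5\<close> are obtained by locating a small induced subgraph and
  giving every vertex a colour that depends only on its \<open>type\<close>, the set of its neighbours in that
  subgraph: two vertices of given types are nonadjacent as soon as an edge between them would
  create a forbidden subgraph. The colourings were found by a computer search.
\<close>

section \<open>Colourings, cliques and induced matchings\<close>

definition colorable :: "('a \<Rightarrow> 'a \<Rightarrow> bool) \<Rightarrow> 'a set \<Rightarrow> nat \<Rightarrow> bool" where
  "colorable E S k \<longleftrightarrow> (\<exists>c. (\<forall>v\<in>S. c v < k) \<and> (\<forall>u\<in>S. \<forall>v\<in>S. E u v \<longrightarrow> c u \<noteq> c v))"

fun has_clique :: "('a \<Rightarrow> 'a \<Rightarrow> bool) \<Rightarrow> nat \<Rightarrow> 'a set \<Rightarrow> bool" where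
  "has_clique E 0 S \<longleftrightarrow> True"
| "has_clique E (Suc n) S \<longleftrightarrow> (\<exists>u\<in>S. has_clique E n {v \<in> S. E u v})"

text \<open>For a symmetric \<open>E\<close> each step also discards \<open>u\<close> and
  \<open>v\<close> themselves, so the chosen edges form an induced matching.\<close>

fun has_matching :: "('a \<Rightarrow> 'a \<Rightarrow> bool) \<Rightarrow> nat \<Rightarrow> 'a set \<Rightarrow> bool" where
  "has_matching E 0 S \<longleftrightarrow> True"
| "has_matching E (Suc n) S \<longleftrightarrow>
     (\<exists>u\<in>S. \<exists>v\<in>S. E u v \<and> has_matching E n {w \<in> S. \<not> E u w \<and> \<not> E v w})"

lemma has_clique_mono: "has_clique E n S \<Longrightarrow> S \<subseteq> T \<Longrightarrow> has_clique E n T"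
proof (induction n arbitrary: S T)
  case (Suc n)
  then obtain u where u: "u \<in> S" "has_clique E n {v \<in> S. E u v}" by auto
  have "has_clique E n {v \<in> T. E u v}"
    by (rule Suc.IH[OF u(2)]) (use Suc.prems in auto)
  then show ?case using u Suc.prems by auto
qed simp

lemma has_matching_mono: "has_matching E n S \<Longrightarrow> S \<subseteq> T \<Longrightarrow> has_matching E n T"
proof (induction n arbitrary: S T)
  case (Suc n)
  then obtain u v where uv: "u \<in> S" "v \<in> S" "E u v"
    "has_matching E n {w \<in> S. \<not> E u w \<and> \<not> E v w}" by auto
  have "has_matching E n {w \<in> T. \<not> E u w \<and> \<not> E v w}"
    by (rule Suc.IH[OF uv(4)]) (use Suc.prems in auto)
  then show ?case using uv Suc.prems by auto
qed simp

lemma has_clique_SucI: "u \<in> S \<Longrightarrow> has_clique E n {v \<in> S. E u v} \<Longrightarrow> has_clique E (Suc n) S"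
  by auto

lemma has_matching_SucI:
  "u \<in> S \<Longrightarrow> v \<in> S \<Longrightarrow> E u v \<Longrightarrow> has_matching E n {w \<in> S. \<not> E u w \<and> \<not> E v w}
    \<Longrightarrow> has_matching E (Suc n) S"
  by auto

lemma colorable_subset: "colorable E T k \<Longrightarrow> S \<subseteq> T \<Longrightarrow> colorable E S k"
  unfolding colorable_def by (meson subsetD)

lemma colorable_mono: "colorable E S j \<Longrightarrow> j \<le> k \<Longrightarrow> colorable E S k"
  unfolding colorable_def by (meson less_le_trans)

lemma colorable_independent: "(\<And>u v. u \<in> S \<Longrightarrow> v \<in> S \<Longrightarrow> \<not> E u v) \<Longrightarrow> colorable E S 1"
  unfolding colorable_def by (rule exI[of _ "\<lambda>_. 0"]) auto

lemma colorable_Un: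
  assumes "colorable E S j" "colorable E T k"
  shows "colorable E (S \<union> T) (j + k)"
proof -
  obtain c where c: "\<forall>v\<in>S. c v < j" "\<forall>u\<in>S. \<forall>v\<in>S. E u v \<longrightarrow> c u \<noteq> c v"
    using assms(1) unfolding colorable_def by auto
  obtain d where d: "\<forall>v\<in>T. d v < k" "\<forall>u\<in>T. \<forall>v\<in>T. E u v \<longrightarrow> d u \<noteq> d v"
    using assms(2) unfolding colorable_def by auto
  let ?e = "\<lambda>v. if v \<in> S then c v else j + d v"
  have "\<forall>v\<in>S \<union> T. ?e v < j + k"
    using c(1) d(1) by (auto intro: trans_less_add1)
  moreover have "\<forall>u\<in>S \<union> T. \<forall>v\<in>S \<union> T. E u v \<longrightarrow> ?e u \<noteq> ?e v"
    using c d by (auto dest: bspec)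
  ultimately show ?thesis unfolding colorable_def by (intro exI[of _ ?e] conjI)
qed

lemma colorable_cover:
  assumes "colorable E S j" "colorable E T k" "R \<subseteq> S \<union> T" "j + k \<le> l"
  shows "colorable E R l"
  using colorable_mono[OF colorable_subset[OF colorable_Un[OF assms(1,2)] assms(3)] assms(4)] .

section \<open>Certificates\<close>

text \<open>Subsets of the vertex list of a subgraph are Boolean masks, and so are the rows of its
  adjacency matrix; passing to neighbours becomes an executable list operation.\<close>

fun select :: "bool list \<Rightarrow> 'b list \<Rightarrow> 'b list" where
  "select (b # S) (a # A) = (if b then a # select S A else select S A)"
| "select _ _ = []"

fun mask_and :: "bool list \<Rightarrow> bool list \<Rightarrow> bool list" where
  "mask_and (a # S) (b # T) = (a \<and> b) # mask_and S T"
| "mask_and _ _ = []"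

fun mask_diff :: "bool list \<Rightarrow> bool list \<Rightarrow> bool list" where
  "mask_diff (a # S) (b # T) = (a \<and> \<not> b) # mask_diff S T"
| "mask_diff _ _ = []"

fun mask_clique :: "bool list list \<Rightarrow> nat \<Rightarrow> bool list \<Rightarrow> bool" where
  "mask_clique A 0 S \<longleftrightarrow> True"
| "mask_clique A (Suc n) S \<longleftrightarrow> list_ex (\<lambda>r. mask_clique A n (mask_and S r)) (select S A)"

fun mask_matching :: "bool list list \<Rightarrow> nat \<Rightarrow> bool list \<Rightarrow> bool" where
  "mask_matching A 0 S \<longleftrightarrow> True"
| "mask_matching A (Suc n) S \<longleftrightarrow>
     list_ex (\<lambda>r. list_ex (\<lambda>r'. mask_matching A n (mask_diff (mask_diff S r) r'))
       (select (mask_and S r) A)) (select S A)"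

definition matrix :: "('a \<Rightarrow> 'a \<Rightarrow> bool) \<Rightarrow> 'a list \<Rightarrow> bool list list" where
  "matrix E hs = map (\<lambda>h. map (E h) hs) hs"

lemma select_map: "select (map P hs) (map f hs) = map f (filter P hs)"
  by (induction hs) auto

lemma mask_and_map: "mask_and (map P hs) (map Q hs) = map (\<lambda>h. P h \<and> Q h) hs"
  by (induction hs) auto

lemma mask_diff_map: "mask_diff (map P hs) (map Q hs) = map (\<lambda>h. P h \<and> \<not> Q h) hs"
  by (induction hs) auto

text \<open>Meeting a mask with the row of a vertex passes to its neighbours, so the two recursions
  run in parallel. Only the set of listed vertices matters, so a repeated vertex does no
  harm.\<close>

lemma mask_clique_iff:
  "mask_clique (matrix E hs) n (map P hs) \<longleftrightarrow> has_clique E n {h \<in> set hs. P h}"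
proof (induction n arbitrary: P)
  case (Suc n)
  have "{v \<in> {h \<in> set hs. P h}. E u v} = {h \<in> set hs. P h \<and> E u h}" for u by auto
  then show ?case
    by (auto simp: matrix_def select_map list_ex_iff mask_and_map Suc.IH[unfolded matrix_def])
qed simp

lemma mask_matching_iff:
  "mask_matching (matrix E hs) n (map P hs) \<longleftrightarrow> has_matching E n {h \<in> set hs. P h}"
proof (induction n arbitrary: P)
  case (Suc n)
  have "{w \<in> {h \<in> set hs. P h}. \<not> E u w \<and> \<not> E v w} = {h \<in> set hs. (P h \<and> \<not> E u h) \<and> \<not> E v h}" for u v
    by auto
  then show ?case
    by (auto simp: matrix_def select_map list_ex_iff mask_and_map mask_diff_map Suc.IH[unfolded matrix_def])
qed simp

text \<open>The graphs considered contain neither a clique of order \<open>w + 2\<close> nor an induced \<open>(p + 1)K\<^sub>2\<close>.\<close>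

definition type_ok :: "nat \<Rightarrow> nat \<Rightarrow> bool list list \<Rightarrow> bool list \<Rightarrow> bool" where
  "type_ok w p A t \<longleftrightarrow> (if mask_clique A (Suc w) t then False
     else list_all (\<lambda>r. \<not> mask_matching A p (mask_diff (map Not t) r)) (select t A))"

text \<open>For the types of two adjacent vertices: a \<open>w\<close>-clique of common neighbours
  would extend by both ends, and an induced \<open>pK\<^sub>2\<close> missed by both would extend by
  their edge.\<close>

definition edge_ok :: "nat \<Rightarrow> nat \<Rightarrow> bool list list \<Rightarrow> bool list \<Rightarrow> bool list \<Rightarrow> bool" where
  "edge_ok w p A s t \<longleftrightarrow> (if mask_clique A w (mask_and s t) then False
     else \<not> mask_matching A p (mask_diff (map Not s) t))"

text \<open>Each type is also compared with itself, because distinct vertices of one type share a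
  colour and must be nonadjacent too.\<close>

fun proper_types :: "nat \<Rightarrow> nat \<Rightarrow> bool list list \<Rightarrow> (nat \<times> bool list) list \<Rightarrow> bool" where
  "proper_types w p A [] \<longleftrightarrow> True"
| "proper_types w p A (x # xs) \<longleftrightarrow>
     list_all (\<lambda>y. if fst y = fst x then \<not> edge_ok w p A (snd x) (snd y) else True) (x # xs)
     \<and> proper_types w p A xs"

fun append_column :: "'b list list \<Rightarrow> 'b list \<Rightarrow> 'b list list" where
  "append_column (r # A) (b # t) = (r @ [b]) # append_column A t"
| "append_column _ _ = []"

definition add_vertex :: "bool list list \<Rightarrow> bool list \<Rightarrow> bool list list" where
  "add_vertex A t = append_column A t @ [t @ [False]]"

text \<open>The filter discards types that no vertex can have. The order produced here is the one to
  which the colour lists refer.\<close>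

definition add_types :: "nat \<Rightarrow> nat \<Rightarrow> bool list list \<Rightarrow> bool list list \<Rightarrow> bool list list" where
  "add_types w p A L = filter (type_ok w p A) (map (\<lambda>l. l @ [False]) L @ map (\<lambda>l. l @ [True]) L)"

definition mask :: "nat \<Rightarrow> nat list \<Rightarrow> bool list" where
  "mask n ns = map (\<lambda>i. i \<in> set ns) [0..<n]"

text \<open>
  A colouring lists the colours of the possible types in the order in which they are enumerated;
  \<open>Split\<close> distinguishes whether some vertex has the given type, in which case it is added to the
  subgraph, or no vertex has it.
\<close>

datatype certificate = Coloring "nat list" | Split "nat list" certificate certificate

fun certifies ::
  "nat \<Rightarrow> nat \<Rightarrow> nat \<Rightarrow> bool list list \<Rightarrow> bool list list \<Rightarrow> certificate \<Rightarrow> bool" where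
  "certifies w p k A L (Coloring cs) \<longleftrightarrow>
     length cs = length L \<and> list_all (\<lambda>c. c < k) cs \<and> proper_types w p A (zip cs L)"
| "certifies w p k A L (Split ns c d) \<longleftrightarrow>
     (let t = mask (length A) ns; A' = add_vertex A t
      in certifies w p k A' (add_types w p A' L) c \<and> certifies w p k A (removeAll t L) d)"

fun certifies_from ::
  "nat \<Rightarrow> nat \<Rightarrow> nat \<Rightarrow> bool list list \<Rightarrow> bool list list \<Rightarrow> nat list list \<Rightarrow> certificate \<Rightarrow> bool" where
  "certifies_from w p k A L [] c \<longleftrightarrow> certifies w p k A L c"
| "certifies_from w p k A L (ns # N) c \<longleftrightarrow>
     (let A' = add_vertex A (mask (length A) ns)
      in certifies_from w p k A' (add_types w p A' L) N c)"

fun embeds :: "('a \<Rightarrow> 'a \<Rightarrow> bool) \<Rightarrow> 'a list \<Rightarrow> 'a list \<Rightarrow> nat list list \<Rightarrow> bool" where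
  "embeds E gs [] [] \<longleftrightarrow> True"
| "embeds E gs (h # hs) (ns # N) \<longleftrightarrow> map (E h) gs = mask (length gs) ns \<and> embeds E (gs @ [h]) hs N"
| "embeds E gs _ _ \<longleftrightarrow> False"

lemma append_column_map: "append_column (map f hs) (map g hs) = map (\<lambda>h. f h @ [g h]) hs"
  by (induction hs) auto

text \<open>An entry is compared only with itself and with later ones, so the test is known for just
  one of the two orders of \<open>i\<close> and \<open>j\<close>.\<close>

lemma proper_types_sound:
  assumes "proper_types w p A (zip cs L)" "i < length cs" "j < length cs" "length cs = length L"
    "cs ! i = cs ! j"
  shows "\<not> edge_ok w p A (L ! i) (L ! j) \<or> \<not> edge_ok w p A (L ! j) (L ! i)"
proof -
  have gen: "\<not> edge_ok w p A (snd (xs ! i)) (snd (xs ! j))"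
    if "proper_types w p A xs" "i \<le> j" "j < length xs" "fst (xs ! i) = fst (xs ! j)" for xs i j
    using that
  proof (induction xs arbitrary: i j)
    case (Cons x xs)
    show ?case
    proof (cases i)
      case 0
      have all: "\<forall>y\<in>set (x # xs). fst y = fst x \<longrightarrow> \<not> edge_ok w p A (snd x) (snd y)"
        using Cons.prems(1) by (simp add: list_all_iff split: if_splits)
      have "(x # xs) ! j \<in> set (x # xs)" using Cons.prems(3) by (rule nth_mem)
      then show ?thesis using 0 all Cons.prems(4) by (metis nth_Cons_0)
    next
      case (Suc i')
      then obtain j' where j': "j = Suc j'" using Cons.prems(2) by (cases j) auto
      have "proper_types w p A xs" using Cons.prems(1) by simp
      from Cons.IH[OF this, of i' j'] show ?thesis using Suc j' Cons.prems(2-4) by simp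
    qed
  qed simp
  show ?thesis
  proof (cases "i \<le> j")
    case True
    then show ?thesis using gen[OF assms(1) True] assms(2-5) by simp
  next
    case False
    then have "j \<le> i" by simp
    then show ?thesis using gen[OF assms(1) \<open>j \<le> i\<close>] assms(2-4) assms(5)[symmetric] by simp
  qed
qed

section \<open>Soundness of the certificates\<close>

locale simple_relation =
  fixes E :: "'a \<Rightarrow> 'a \<Rightarrow> bool"
  assumes sym: "E u v \<Longrightarrow> E v u"
    and irrefl: "\<not> E u u"
begin

lemma matrix_snoc: "matrix E (hs @ [h]) = add_vertex (matrix E hs) (map (E h) hs)"
proof -
  have "E h x = E x h" for x using sym by blast
  then show ?thesis
    by (simp add: matrix_def add_vertex_def append_column_map irrefl)
qed

context
  fixes V :: "'a set" and w p k :: nat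
  assumes no_clique: "\<not> has_clique E (Suc (Suc w)) V"
    and no_matching: "\<not> has_matching E (Suc p) V"
begin

text \<open>A clique in the neighbourhood of \<open>v\<close> extends by \<open>v\<close>; an
  induced matching missed by both ends of an edge \<open>v h\<close> extends by that edge.\<close>

lemma type_ok_vertex:
  assumes "set hs \<subseteq> V" "v \<in> V"
  shows "type_ok w p (matrix E hs) (map (E v) hs)"
proof -
  have "\<not> mask_clique (matrix E hs) (Suc w) (map (E v) hs)"
  proof
    assume "mask_clique (matrix E hs) (Suc w) (map (E v) hs)"
    then have "has_clique E (Suc w) {h \<in> set hs. E v h}" by (simp only: mask_clique_iff)
    then have "has_clique E (Suc w) {h \<in> V. E v h}" by (rule has_clique_mono) (use assms in auto)
    then show False using has_clique_SucI[OF assms(2)] no_clique by blast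
  qed
  moreover have "\<not> mask_matching (matrix E hs) p (mask_diff (map Not (map (E v) hs)) (map (E h) hs))"
    if "h \<in> set hs" "E v h" for h
  proof
    have eq: "mask_diff (map Not (map (E v) hs)) (map (E h) hs)
        = map (\<lambda>g. \<not> E v g \<and> \<not> E h g) hs"
      using mask_diff_map[of "\<lambda>g. \<not> E v g" hs "E h"] by (simp add: comp_def)
    assume "mask_matching (matrix E hs) p (mask_diff (map Not (map (E v) hs)) (map (E h) hs))"
    then have "has_matching E p {g \<in> set hs. \<not> E v g \<and> \<not> E h g}"
      by (simp only: eq mask_matching_iff)
    then have "has_matching E p {g \<in> V. \<not> E v g \<and> \<not> E h g}"
      by (rule has_matching_mono) (use assms in auto)
    then show False using has_matching_SucI[of v V h E p] no_matching assms that by blast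
  qed
  ultimately show ?thesis
    unfolding type_ok_def
    by (auto simp: list_all_iff select_map matrix_def)
qed

lemma edge_ok_edge:
  assumes "set hs \<subseteq> V" "u \<in> V" "v \<in> V" "E u v"
  shows "edge_ok w p (matrix E hs) (map (E u) hs) (map (E v) hs)"
proof -
  have "\<not> mask_clique (matrix E hs) w (mask_and (map (E u) hs) (map (E v) hs))"
  proof
    assume "mask_clique (matrix E hs) w (mask_and (map (E u) hs) (map (E v) hs))"
    then have "has_clique E w {h \<in> set hs. E u h \<and> E v h}" by (simp only: mask_and_map mask_clique_iff)
    then have "has_clique E w {h \<in> {h \<in> V. E u h}. E v h}"
      by (rule has_clique_mono) (use assms in auto)
    then have "has_clique E (Suc w) {h \<in> V. E u h}"
      using assms by (intro has_clique_SucI[of v]) auto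
    then show False using no_clique has_clique_SucI[OF assms(2)] by blast
  qed
  moreover have "\<not> mask_matching (matrix E hs) p (mask_diff (map Not (map (E u) hs)) (map (E v) hs))"
  proof
    have eq: "mask_diff (map Not (map (E u) hs)) (map (E v) hs)
        = map (\<lambda>g. \<not> E u g \<and> \<not> E v g) hs"
      using mask_diff_map[of "\<lambda>g. \<not> E u g" hs "E v"] by (simp add: comp_def)
    assume "mask_matching (matrix E hs) p (mask_diff (map Not (map (E u) hs)) (map (E v) hs))"
    then have "has_matching E p {g \<in> set hs. \<not> E u g \<and> \<not> E v g}"
      by (simp only: eq mask_matching_iff)
    then have "has_matching E p {g \<in> V. \<not> E u g \<and> \<not> E v g}"
      by (rule has_matching_mono) (use assms in auto)
    then show False using has_matching_SucI[of u V v E p] no_matching assms by blast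
  qed
  ultimately show ?thesis unfolding edge_ok_def by simp
qed

lemma add_types_snoc:
  assumes "set hs \<subseteq> V" "h \<in> V" "\<forall>v\<in>V. map (E v) hs \<in> set L"
  shows "\<forall>v\<in>V. map (E v) (hs @ [h]) \<in> set (add_types w p (matrix E (hs @ [h])) L)"
proof
  fix v assume v: "v \<in> V"
  have "map (E v) (hs @ [h]) = map (E v) hs @ [E v h]" by simp
  then show "map (E v) (hs @ [h]) \<in> set (add_types w p (matrix E (hs @ [h])) L)"
    using type_ok_vertex[of "hs @ [h]" v] assms v unfolding add_types_def
    by (cases "E v h") auto
qed

text \<open>The invariant is that \<open>L\<close> contains the types of all vertices. At a split, a
  vertex of the given type refines the types; if there is none, deleting the type keeps the
  invariant.\<close>

lemma certifies_sound:
  assumes "certifies w p k (matrix E hs) L c" "set hs \<subseteq> V" "\<forall>v\<in>V. map (E v) hs \<in> set L"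
  shows "colorable E V k"
  using assms
proof (induction c arbitrary: hs L)
  case (Coloring cs)
  let ?t = "\<lambda>v. map (E v) hs"
  \<comment> \<open>The chosen position depends on \<open>v\<close> only through its type, which
    makes the colour a function of the type.\<close>
  let ?i = "\<lambda>v. SOME i. i < length L \<and> L ! i = ?t v"
  have i: "?i v < length L" "L ! ?i v = ?t v" if "v \<in> V" for v
    using someI_ex[of "\<lambda>i. i < length L \<and> L ! i = ?t v"] that Coloring.prems(3)
    by (auto simp: in_set_conv_nth)
  have len: "length cs = length L" and lt: "\<forall>c\<in>set cs. c < k"
    and proper: "proper_types w p (matrix E hs) (zip cs L)"
    using Coloring.prems(1) by (auto simp: list_all_iff)
  have "cs ! ?i u \<noteq> cs ! ?i v" if "u \<in> V" "v \<in> V" "E u v" for u v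
  proof
    assume "cs ! ?i u = cs ! ?i v"
    from proper_types_sound[OF proper _ _ len this] i[OF that(1)] i[OF that(2)] len
    have "\<not> edge_ok w p (matrix E hs) (?t u) (?t v) \<or> \<not> edge_ok w p (matrix E hs) (?t v) (?t u)"
      by simp
    then show False
      using edge_ok_edge[OF Coloring.prems(2)] that sym[OF that(3)] by blast
  qed
  moreover have "cs ! ?i v < k" if "v \<in> V" for v
    using i[OF that] lt len by simp
  ultimately show ?case
    unfolding colorable_def by (intro exI[of _ "\<lambda>v. cs ! ?i v"]) blast
next
  case (Split ns c d)
  let ?t = "mask (length (matrix E hs)) ns"
  show ?case
  proof (cases "\<exists>h\<in>V. map (E h) hs = ?t")
    case True
    then obtain h where h: "h \<in> V" "map (E h) hs = ?t" by blast
    have "add_vertex (matrix E hs) ?t = matrix E (hs @ [h])"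
      by (simp only: matrix_snoc h(2))
    then have "certifies w p k (matrix E (hs @ [h])) (add_types w p (matrix E (hs @ [h])) L) c"
      using Split.prems(1) by (simp add: Let_def)
    then show ?thesis
      using Split.IH(1) h(1) Split.prems(2,3) add_types_snoc by simp
  next
    case False
    then show ?thesis
      using Split.IH(2)[of hs "removeAll ?t L"] Split.prems by (auto simp: Let_def)
  qed
qed

lemma certifies_from_sound:
  assumes "certifies_from w p k (matrix E gs) L N c" "embeds E gs hs N"
    "set gs \<subseteq> V" "set hs \<subseteq> V" "\<forall>v\<in>V. map (E v) gs \<in> set L"
  shows "colorable E V k"
  using assms
proof (induction N arbitrary: gs hs L)
  case Nil
  then show ?case using certifies_sound by simp
next
  case (Cons ns N)
  then obtain h hs' where hs: "hs = h # hs'" by (cases hs) auto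
  have "add_vertex (matrix E gs) (mask (length (matrix E gs)) ns) = matrix E (gs @ [h])"
    using Cons.prems(2) by (simp add: hs matrix_snoc) (simp add: matrix_def)
  then show ?case
    using Cons.IH[of "gs @ [h]" _ hs'] Cons.prems add_types_snoc[of gs h L] by (simp add: hs Let_def)
qed

text \<open>Over the empty subgraph every vertex has the type \<open>[]\<close>, so the invariant
  holds at the start.\<close>

theorem colorable_certificate:
  assumes "certifies_from w p k [] [[]] N c" "embeds E [] hs N" "set hs \<subseteq> V"
  shows "colorable E V k"
  using certifies_from_sound[of "[]" "[[]]" N c hs] assms by (simp add: matrix_def)

end

end

section \<open>Colouring certificates for the exceptional configurations\<close>

text \<open>
  A subgraph is given by the lists of the earlier neighbours of its vertices. The vertices 0 to 4
  form a pentagon, which the edge between 5 and 6 misses.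
\<close>

definition pentagon_edge :: "nat list list" where
  "pentagon_edge = [[], [0], [1], [2], [0, 3], [], [5]]"

text \<open>
  The vertices 5, 6, 7, 9, 8 form a second pentagon; \<open>a\<close> and \<open>b\<close> are the neighbours of 7 and 8
  in the first one, and 9 has none there.
\<close>

definition joined_pentagons :: "nat list \<Rightarrow> nat list \<Rightarrow> nat list list" where
  "joined_pentagons a b = pentagon_edge @ [a @ [6], b @ [5], [7, 8]]"

text \<open>The lists \<open>a\<close> and \<open>b\<close> range over the independent sets of the
  path 2, 3, 4. The fifteen unordered pairs are spread over four tables.\<close>

definition joined_pentagons_first :: "(nat list \<times> nat list \<times> certificate) list" where
  "joined_pentagons_first = [
    ([2,4],[2,4],Split [0,6,8] (Coloring [1, 1, 1, 2, 3, 1, 1, 1, 0, 0, 0, 0, 0, 1, 2, 1, 1,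
    2, 1, 0, 0, 0, 0, 1, 1, 2, 3, 0, 0, 0, 0, 0, 0, 3, 2, 2, 3, 2, 2, 2, 2, 3, 2, 2, 3, 2, 3,
    2, 3, 2, 3]) (Split [1,3,5,9] (Coloring [0, 2, 1, 1, 2, 2, 2, 2, 3, 0, 2, 2, 0, 2, 0, 2, 2,
    0, 0, 2, 1, 2, 1, 2, 2, 1, 2, 1, 3, 3, 1, 3, 1, 1, 0, 1, 3, 3, 3, 0]) (Split [0,5] (Coloring
    [1, 0, 1, 0, 1, 0, 0, 1, 0, 0, 0, 1, 0, 1, 0, 1, 0, 2, 0, 3, 0, 0, 3, 3, 2, 2, 2, 3, 2, 2,
    2, 2, 2, 2, 2, 2, 2, 2, 3, 2, 3, 2, 3, 2, 3]) (Split [1,3,6,9] (Coloring [1, 2, 1, 1, 3, 2,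
    2, 2, 1, 2, 0, 2, 2, 2, 2, 2, 0, 0, 2, 3, 1, 1, 1, 1, 2, 1, 2, 2, 1, 1, 1, 0, 0, 1, 3, 3,
    0, 0]) (Split [1,6] (Coloring [1, 2, 2, 2, 2, 0, 0, 0, 0, 0, 2, 1, 0, 0, 0, 1, 1, 1, 2, 0,
    0, 0, 0, 1, 3, 1, 3, 3, 3, 1, 3, 3, 3, 1, 1, 1, 3, 3, 3, 3, 3, 2, 2]) (Split [1,3,6] (
    Coloring [3, 3, 3, 3, 3, 1, 1, 1, 3, 3, 3, 3, 0, 0, 0, 0, 0, 0, 0, 0, 0, 3, 3, 2, 1, 1, 1,
    1, 1, 1, 1, 2, 2, 2, 2, 2, 2, 0, 2, 2, 2, 2, 2, 2]) (Split [1,6,9] (Coloring [1, 3, 0, 0, 1,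
    3, 0, 0, 3, 0, 0, 0, 3, 0, 1, 3, 0, 2, 2, 2, 2, 2, 2, 0, 2, 2, 2, 0, 2, 1, 1, 3, 1, 3, 3,
    3, 1, 3, 3, 3, 1, 3]) (Split [0,5,9] (Coloring [2, 1, 1, 3, 2, 1, 1, 3, 1, 3, 3, 1, 1, 3, 1,
    3, 1, 3, 2, 1, 2, 2, 1, 1, 2, 2, 2, 1, 2, 1, 1, 2, 0, 0, 0, 0, 0, 0, 0, 0, 0, 0, 0, 0]) (
    Split [1,3,6,8] (Coloring [1, 3, 0, 0, 2, 0, 1, 0, 3, 0, 2, 3, 0, 3, 0, 3, 0, 1, 0, 1, 0,
    3, 3, 0, 2, 0, 2, 1, 1, 1, 1, 1, 1, 0, 1, 2, 3, 2, 2, 2, 3, 2, 2, 2, 2, 2]) (Split [1,6,8] (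
    Coloring [1, 2, 1, 1, 3, 1, 1, 1, 0, 0, 0, 2, 1, 1, 2, 1, 1, 0, 0, 1, 2, 1, 3, 0, 0, 0, 0,
    3, 2, 2, 3, 2, 2, 2, 3, 2, 2, 3, 3, 2, 2, 3, 3]) (Coloring [0, 3, 3, 0, 0, 1, 2, 2, 2, 2, 2,
    3, 1, 3, 1, 3, 0, 2, 2, 2, 2, 2, 3, 0, 1, 3, 0, 3, 0, 2, 2, 2, 2, 2, 2, 2, 2, 1, 3, 1, 1,
    3, 1, 1, 1])))))))))))]"

text \<open>The parameters \<open>1 2 4\<close> stand for: no triangle, no induced
  \<open>3K\<^sub>2\<close>, four colours.\<close>

lemma joined_pentagons_first_certified:
  "list_all (\<lambda>(a, b, c). certifies_from 1 2 4 [] [[]] (joined_pentagons a b) c) joined_pentagons_first"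
  by code_simp

definition joined_pentagons_second :: "(nat list \<times> nat list \<times> certificate) list" where
  "joined_pentagons_second = [
    ([2,4],[2],Split [1,4,6] (Coloring [1, 0, 1, 0, 0, 2, 0, 0, 1, 1, 0, 0, 0, 0, 3, 3, 0, 2,
    2, 2, 2, 1, 1, 1, 1, 0, 1, 3, 3, 3, 2, 2, 2, 3, 2, 2, 2, 3, 3, 3, 2, 2, 2, 2, 2]) (Split
    [1,6,8] (Coloring [1, 2, 1, 3, 1, 1, 2, 1, 2, 1, 1, 0, 0, 0, 0, 0, 0, 0, 1, 2, 1, 3, 2, 0,
    0, 0, 3, 2, 2, 3, 2, 2, 2, 2, 3, 2, 2, 3, 2, 3, 2, 2, 3, 3]) (Split [1,3,6,8] (Coloring [0,
    1, 0, 0, 1, 1, 1, 1, 2, 2, 1, 1, 1, 1, 0, 0, 1, 1, 0, 0, 0, 1, 1, 3, 3, 2, 3, 3, 3, 1, 3,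
    3, 3, 2, 2, 0, 2, 2, 2, 2, 2, 2, 2, 2, 2, 2]) (Coloring [0, 2, 2, 0, 1, 2, 2, 2, 3, 3, 2, 2,
    0, 3, 2, 2, 0, 2, 0, 0, 1, 2, 2, 1, 1, 0, 2, 0, 3, 2, 3, 3, 2, 2, 3, 3, 3, 3, 2, 1, 1, 2,
    1, 1, 1])))),
    ([2,4],[3],Coloring [0, 0, 2, 2, 3, 3, 2, 2, 2, 2, 0, 2, 2, 1, 1, 1, 1, 1, 1, 1, 1, 1, 1,
    1, 0, 0, 2, 2, 0, 0, 3, 0, 3]),
    ([2,4],[4],Split [1,6,8] (Coloring [0, 0, 1, 1, 0, 1, 1, 1, 0, 1, 2, 1, 1, 2, 1, 0, 1, 0,
    0, 1, 0, 0, 1, 0, 2, 1, 3, 1, 1, 3, 1, 3, 2, 2, 3, 2, 2, 2, 2, 2, 3, 2, 3, 2, 2, 3, 3]) (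
    Split [1,3,6,8] (Coloring [0, 2, 2, 0, 2, 2, 1, 2, 3, 2, 1, 2, 1, 2, 0, 0, 1, 2, 1, 1, 2,
    3, 2, 3, 2, 0, 0, 2, 0, 0, 0, 3, 1, 0, 3, 3, 3, 3, 3, 3, 3, 3]) (Coloring [3, 0, 3, 3, 1, 2,
    2, 2, 2, 2, 1, 3, 0, 3, 2, 2, 0, 2, 0, 0, 3, 1, 0, 1, 0, 0, 0, 0, 3, 2, 2, 2, 2, 2, 2, 2,
    2, 2, 2, 3, 1, 1, 3, 1, 1, 1]))),
    ([2,4],[],Coloring [0, 2, 3, 0, 2, 2, 3, 3, 2, 3, 2, 2, 3, 1, 1, 1, 1, 1, 1, 1, 1, 1, 1,
    1, 1, 1, 1, 1, 1, 1, 0, 2, 3, 0, 2, 2, 3, 0, 3, 0, 0, 0, 0, 0])]"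

lemma joined_pentagons_second_certified:
  "list_all (\<lambda>(a, b, c). certifies_from 1 2 4 [] [[]] (joined_pentagons a b) c) joined_pentagons_second"
  by code_simp

definition joined_pentagons_third :: "(nat list \<times> nat list \<times> certificate) list" where
  "joined_pentagons_third = [
    ([2],[2],Coloring [0, 2, 0, 0, 1, 1, 2, 1, 3, 1, 0, 1, 2, 2, 2, 0, 1, 1, 0, 1, 3, 3, 3,
    0, 1, 1, 0, 0, 0, 1, 2, 2, 2, 2, 1, 1, 1, 3, 3, 3, 3, 1, 1, 1]),
    ([2],[3],Coloring [2, 1, 2, 3, 0, 1, 1, 3, 1, 1, 1, 1, 1, 2, 2, 0, 0, 0, 0, 0, 0, 1, 1,
    3, 3, 3, 2, 0, 0, 0, 0]),
    ([2],[4],Coloring [2, 0, 1, 3, 2, 1, 3, 1, 0, 1, 1, 2, 1, 0, 1, 2, 1, 0, 0, 1, 3, 0, 3,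
    0, 0, 1, 0, 0, 1, 2, 2, 2, 2, 2, 1, 2, 1, 3, 3, 1, 3, 1, 3]),
    ([2],[],Coloring [0, 1, 0, 1, 3, 3, 0, 0, 0, 0, 0, 0, 2, 2, 2, 1, 1, 2, 2, 2, 1, 0, 0, 0,
    0, 3, 1, 1, 3, 3, 3, 1, 1, 1, 2, 1]),
    ([3],[3],Coloring [0, 0, 2, 1, 1, 0, 2, 1, 3, 1, 0, 1, 2, 2, 1, 2, 1, 0, 0, 1, 3, 3, 1,
    3, 1, 0, 0, 0, 1, 0, 2, 1, 2, 2, 2, 1, 1, 3, 1, 3, 3, 3, 1, 1])]"

lemma joined_pentagons_third_certified:
  "list_all (\<lambda>(a, b, c). certifies_from 1 2 4 [] [[]] (joined_pentagons a b) c) joined_pentagons_third"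
  by code_simp

definition joined_pentagons_fourth :: "(nat list \<times> nat list \<times> certificate) list" where
  "joined_pentagons_fourth = [
    ([3],[4],Coloring [3, 0, 1, 2, 2, 1, 1, 2, 1, 1, 1, 1, 1, 0, 0, 0, 2, 0, 0, 0, 0, 0, 0,
    3, 3, 3, 2, 3, 2, 3, 1]),
    ([3],[],Coloring [0, 1, 1, 0, 3, 3, 0, 0, 0, 0, 0, 0, 2, 2, 2, 2, 2, 1, 1, 1, 2, 0, 0, 0,
    0, 3, 3, 3, 1, 1, 1, 3, 1, 1, 1, 2]),
    ([4],[4],Coloring [0, 0, 0, 1, 1, 2, 2, 1, 3, 1, 0, 1, 2, 1, 2, 2, 0, 1, 0, 1, 3, 1, 3,
    3, 0, 1, 0, 0, 0, 1, 1, 2, 2, 1, 2, 1, 2, 1, 3, 3, 1, 3, 1, 3]),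
    ([4],[],Coloring [0, 0, 1, 1, 3, 3, 0, 0, 0, 0, 0, 0, 2, 2, 2, 2, 2, 2, 1, 1, 1, 0, 0, 0,
    0, 3, 3, 3, 3, 1, 1, 1, 1, 2, 1, 1]),
    ([],[],Split [0,3,5,9] (Coloring [0, 0, 0, 1, 1, 0, 0, 1, 1, 2, 2, 3, 2, 2, 2, 1, 1, 2,
    0, 0, 0, 1, 3, 0, 0, 3, 3, 3, 1, 2, 3, 2, 2, 2, 1, 2]) (Split [2,4,7,8] (Coloring [0, 0, 1,
    1, 1, 0, 0, 2, 1, 1, 3, 0, 0, 3, 3, 3, 1, 0, 1, 1, 0, 2, 2, 0, 0, 2, 2, 0, 2, 2, 2, 3, 0, 2]
    ) (Coloring [0, 0, 0, 1, 1, 2, 1, 0, 0, 1, 1, 2, 3, 0, 0, 3, 3, 3, 0, 0, 0, 1, 1, 2, 2, 1,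
    1, 2, 3, 2, 3, 3, 2, 2])))]"

lemma joined_pentagons_fourth_certified:
  "list_all (\<lambda>(a, b, c). certifies_from 1 2 4 [] [[]] (joined_pentagons a b) c) joined_pentagons_fourth"
  by code_simp

definition joined_pentagons_table :: "(nat list \<times> nat list \<times> certificate) list" where
  "joined_pentagons_table =
     joined_pentagons_first @ joined_pentagons_second @ joined_pentagons_third @ joined_pentagons_fourth"

lemma joined_pentagons_certified:
  "list_all (\<lambda>(a, b, c). certifies_from 1 2 4 [] [[]] (joined_pentagons a b) c)
     joined_pentagons_table"
  unfolding joined_pentagons_table_def list_all_append
  using joined_pentagons_first_certified joined_pentagons_second_certified
    joined_pentagons_third_certified joined_pentagons_fourth_certified by blast

text \<open>Exchanging 5 with 6 and 7 with 8 reflects the second pentagon and swaps \<open>a\<close>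
  with \<open>b\<close>, so one order of each pair suffices.\<close>

lemma joined_pentagons_complete:
  "list_all (\<lambda>a. list_all (\<lambda>b. list_ex (\<lambda>(a', b', c). (a = a' \<and> b = b') \<or> (a = b' \<and> b = a'))
     joined_pentagons_table) [[2, 4], [2], [3], [4], []]) [[2, 4], [2], [3], [4], []]"
  by code_simp

text \<open>
  Here the edge between 5 and 6 lies in the pentagons 5, 6, 7, 3, 8 and 5, 6, 9, 4, 10.
\<close>

definition three_pentagons :: "nat list \<Rightarrow> nat list \<Rightarrow> nat list list" where
  "three_pentagons a b = pentagon_edge @ [[3, 6], [3, 5], a, b]"

text \<open>The adjacencies of 8 with 9 and of 7 with 10 are undetermined, which leaves four
  cases.\<close>

definition three_pentagons_table :: "(nat list \<times> nat list \<times> certificate) list" where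
  "three_pentagons_table = [
    ([4,6],[4,5],Coloring [2, 1, 2, 2, 3, 2, 2, 1, 2, 2, 0, 3, 3, 3, 2, 0, 3, 0, 1, 1, 1, 1,
    0, 1, 0, 2, 0, 0, 0, 0, 0]),
    ([4,6,8],[4,5],Coloring [0, 0, 1, 1, 0, 2, 1, 2, 2, 1, 3, 1, 1, 2, 1, 2, 0, 0, 2, 2, 2,
    2, 3, 0, 3, 3, 0, 2, 3, 3, 3, 3, 2, 3, 0, 2]),
    ([4,6],[4,5,7],Coloring [3, 3, 2, 0, 0, 2, 0, 0, 2, 0, 1, 2, 0, 2, 0, 2, 1, 0, 2, 0, 2,
    3, 0, 2, 2, 2, 3, 1, 1, 2, 1, 2, 2, 2, 1, 1]),
    ([4,6,8],[4,5,7],Coloring [3, 2, 0, 0, 2, 0, 2, 1, 1, 2, 1, 2, 0, 3, 2, 0, 0, 2, 0, 0, 0,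
    0, 0, 0, 0, 2, 1, 1, 2, 1, 1, 1, 1, 1, 1, 1, 2, 2, 0])]"

lemma three_pentagons_certified:
  "list_all (\<lambda>(a, b, c). certifies_from 1 2 4 [] [[]] (three_pentagons a b) c)
     three_pentagons_table"
  by code_simp

section \<open>The wheel with five spokes\<close>

definition wheel :: "nat list list" where
  "wheel = [[], [0], [1], [2], [0, 3], [0, 1, 2, 3, 4]]"

definition wheel_certificate :: certificate where
  "wheel_certificate =
    Split [0,1,2,3] (Split [0,3,5,6] (Coloring [0, 4, 3, 4, 4, 4, 2, 0, 3, 3, 3, 1, 0, 0, 1, 3,
    0, 4, 4, 4, 4, 2, 2, 2, 2, 2, 0, 1, 0, 1]) (Coloring [0, 3, 3, 4, 4, 3, 2, 2, 2, 2, 2, 0, 3,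
    3, 0, 4, 1, 1, 4, 0, 1, 0, 0, 1])) (Split [0,1,3] (Split [0,2,5] (Coloring [0, 4, 4, 4, 4,
    2, 2, 0, 0, 4, 0, 0, 3, 2, 3, 2, 2, 1, 3, 2, 3, 2, 3, 1, 1]) (Split [0,2,4,6] (Coloring [0,
    0, 0, 0, 0, 0, 0, 0, 4, 2, 4, 2, 1, 2, 2, 1, 1, 4, 0, 4, 1, 3, 3, 1, 4, 1, 3, 1, 1]) (Split
    [0,3,5,6] (Coloring [0, 3, 3, 2, 0, 0, 1, 2, 0, 0, 0, 1, 2, 3, 3, 2, 3, 2, 3, 2, 2, 1, 4,
    4, 1, 4]) (Split [0,2,3,4,6] (Coloring [0, 3, 4, 0, 0, 0, 0, 3, 0, 0, 3, 3, 3, 1, 1, 2, 3,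
    1, 1, 2, 2, 2, 2, 2]) (Coloring [0, 3, 3, 4, 1, 3, 4, 1, 4, 1, 1, 0, 3, 2, 2, 4, 4, 4, 0, 0,
    2, 2, 0]))))) (Split [0,2,3] (Split [1,3,5] (Coloring [0, 2, 2, 2, 4, 4, 0, 2, 0, 0, 0, 3,
    4, 3, 4, 4, 1, 3, 3, 3, 4, 4, 1, 1]) (Split [0,3] (Coloring [0, 1, 1, 4, 1, 1, 1, 2, 0, 3,
    3, 4, 4, 0, 3, 3, 4, 2, 2, 3, 0, 2, 2, 3, 4, 0, 0]) (Coloring [0, 4, 3, 1, 4, 4, 1, 1, 1, 0,
    2, 2, 0, 4, 4, 4, 3, 3, 0, 2, 2, 3, 0, 0]))) (Split [1,3] (Coloring [0, 4, 3, 3, 3, 3, 2, 3,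
    2, 0, 4, 1, 1, 2, 2, 2, 2, 0, 4, 1, 0]) (Coloring [0, 4, 3, 4, 4, 4, 4, 4, 2, 2, 2, 2, 2, 0,
    1, 3, 0, 0, 1]))))"

text \<open>The parameters \<open>2 1 5\<close> stand for: no clique of order four, no induced
  \<open>2K\<^sub>2\<close>, five colours.\<close>

lemma wheel_certified: "certifies_from 2 1 5 [] [[]] wheel wheel_certificate"
  by code_simp


section \<open>Graphs without a clique of order four\<close>

lemma has_clique_3: "has_clique E 3 S \<longleftrightarrow> (\<exists>u\<in>S. \<exists>v\<in>S. \<exists>w\<in>S. E u v \<and> E u w \<and> E v w)"
  by (auto simp: numeral_eq_Suc)

lemma has_matching_1: "has_matching E 1 S \<longleftrightarrow> (\<exists>u\<in>S. \<exists>v\<in>S. E u v)"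
  by auto

lemma no_clique_neighbours:
  "\<not> has_clique E (Suc n) S \<Longrightarrow> u \<in> S \<Longrightarrow> \<not> has_clique E n {v \<in> S. E u v}"
  by auto

lemma no_matching_anticomplete:
  "\<not> has_matching E (Suc n) S \<Longrightarrow> u \<in> S \<Longrightarrow> v \<in> S \<Longrightarrow> E u v \<Longrightarrow>
    \<not> has_matching E n {w \<in> S. \<not> E u w \<and> \<not> E v w}"
  by auto

lemma colorable_no_edge: "\<not> has_matching E 1 S \<Longrightarrow> colorable E S 1"
  unfolding has_matching_1 by (rule colorable_independent) blast

context simple_relation
begin

section \<open>Recursive bounds and their base cases\<close>

lemma neighbours_colorable:
  assumes "\<not> has_clique E 3 S" "u \<in> S"
  shows "colorable E {v \<in> S. E u v} 1"
  by (rule colorable_independent) (use assms in \<open>auto simp: has_clique_3\<close>)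

lemma triangle_free_step:
  assumes "\<not> has_clique E 3 S" "u \<in> S" "v \<in> S"
    "colorable E {w \<in> S. \<not> E u w \<and> \<not> E v w} k"
  shows "colorable E S (k + 2)"
proof -
  have "colorable E ({w \<in> S. E u w} \<union> {w \<in> S. E v w}) (1 + 1)"
    by (rule colorable_Un) (use neighbours_colorable[OF assms(1)] assms in auto)
  from colorable_cover[OF this assms(4)] show ?thesis by auto
qed

lemma triangle_free_colorable_Suc:
  assumes "\<not> has_clique E 3 S" "\<not> has_matching E (Suc p) S"
    and "\<And>T. \<not> has_clique E 3 T \<Longrightarrow> \<not> has_matching E p T \<Longrightarrow> colorable E T k"
  shows "colorable E S (k + 2)"
proof (cases "has_matching E 1 S")
  case True
  then obtain u v where uv: "u \<in> S" "v \<in> S" "E u v" unfolding has_matching_1 by blast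
  have "\<not> has_clique E 3 {w \<in> S. \<not> E u w \<and> \<not> E v w}"
    using assms(1) has_clique_mono[of E 3 "{w \<in> S. \<not> E u w \<and> \<not> E v w}" S] by blast
  then show ?thesis
    using triangle_free_step[OF assms(1) uv(1,2)] assms(3) no_matching_anticomplete[OF assms(2) uv]
    by blast
next
  case False
  then show ?thesis using colorable_no_edge colorable_mono[of E S 1 "k + 2"] by auto
qed

lemma triangle_free_2K2_free_colorable:
  assumes "\<not> has_clique E 3 S" "\<not> has_matching E 2 S"
  shows "colorable E S 3"
proof -
  have "\<not> has_matching E (Suc 1) S" using assms(2) unfolding Suc_1 .
  from assms(1) this have "colorable E S (1 + 2)"
    by (rule triangle_free_colorable_Suc) (rule colorable_no_edge)
  then show ?thesis by (rule colorable_mono) simp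
qed

text \<open>The vertices missing both \<open>u\<close> and \<open>v\<close> are independent. If one
  of them has neighbours next to \<open>u\<close> and next to \<open>v\<close>, a pentagon closes,
  and it is induced since there are no triangles. Otherwise \<open>S\<close> splits into two
  independent sets.\<close>

lemma pentagon_through_edge:
  assumes "\<not> has_clique E 3 S" "\<not> has_matching E 2 S" "\<not> colorable E S 2"
    and uv: "u \<in> S" "v \<in> S" "E u v"
  obtains x y z where "x \<in> S" "y \<in> S" "z \<in> S" "E v x" "E x y" "E y z" "E z u"
    "\<not> E u x" "\<not> E u y" "\<not> E v y" "\<not> E v z" "\<not> E x z"
proof -
  have triangle: False if "a \<in> S" "b \<in> S" "c \<in> S" "E a b" "E a c" "E b c" for a b c
    using assms(1) that unfolding has_clique_3 by blast
  let ?Z = "{w \<in> S. \<not> E u w \<and> \<not> E v w}"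
  have "\<not> has_matching E 1 ?Z"
    using no_matching_anticomplete[of E 1 S u v] assms(2) uv unfolding Suc_1 by blast
  then have Z: "\<not> E a b" if "a \<in> ?Z" "b \<in> ?Z" for a b
    using that unfolding has_matching_1 by blast
  have "\<exists>y\<in>?Z. (\<exists>z\<in>S. E u z \<and> E y z) \<and> (\<exists>x\<in>S. E v x \<and> E y x)"
  proof (rule ccontr)
    assume none: "\<not> ?thesis"
    \<comment> \<open>The neighbours of \<open>u\<close> are joined by the vertices of
      \<open>?Z\<close> that miss them all; by \<open>none\<close> the other vertices of
      \<open>?Z\<close> miss all neighbours of \<open>v\<close>.\<close>
    let ?A = "{w \<in> S. E u w} \<union> {y \<in> ?Z. \<not> (\<exists>z\<in>S. E u z \<and> E y z)}"
    let ?B = "{w \<in> S. E v w} \<union> {y \<in> ?Z. \<exists>z\<in>S. E u z \<and> E y z}"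
    have "colorable E ?A 1"
      by (rule colorable_independent) (use triangle uv Z sym in blast)
    moreover have "colorable E ?B 1"
      by (rule colorable_independent) (use triangle uv Z sym none in blast)
    ultimately have "colorable E S 2"
      by (rule colorable_cover) auto
    with assms(3) show False ..
  qed
  then obtain x y z where "y \<in> ?Z" "z \<in> S" "E u z" "E y z" "x \<in> S" "E v x" "E y x" by blast
  then show ?thesis using that[of x y z] triangle uv sym by blast
qed

lemma K4_free_colorable_Suc:
  assumes "\<not> has_clique E 4 S" "\<not> has_matching E (Suc p) S"
    and g: "\<And>T. \<not> has_clique E 3 T \<Longrightarrow> \<not> has_matching E (Suc p) T \<Longrightarrow> colorable E T i"
    and g': "\<And>T. \<not> has_clique E 3 T \<Longrightarrow> \<not> has_matching E p T \<Longrightarrow> colorable E T j"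
    and f: "\<And>T. \<not> has_clique E 4 T \<Longrightarrow> \<not> has_matching E p T \<Longrightarrow> colorable E T k"
  shows "colorable E S (i + j + 1 + k)"
proof (cases "has_clique E 3 S")
  case True
  then obtain a b c where abc: "a \<in> S" "b \<in> S" "c \<in> S" "E a b" "E a c" "E b c"
    unfolding has_clique_3 by blast
  have nbr: "\<not> has_clique E 3 {w \<in> S. E x w}" if "x \<in> S" for x
    using no_clique_neighbours[of E 3 S x] assms(1) that by simp
  let ?A = "{w \<in> S. E a w}"
  let ?B = "{w \<in> S. E b w \<and> \<not> E a w \<and> \<not> E c w}"
  let ?C = "{w \<in> S. \<not> E a w \<and> E b w \<and> E c w}"
  let ?D = "{w \<in> S. \<not> E a w \<and> \<not> E b w}"
  have "colorable E ?A i"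
    by (rule g[OF nbr[OF abc(1)]]) (use assms(2) has_matching_mono[of E "Suc p" ?A S] in blast)
  moreover have "colorable E ?B j"
  proof (rule g')
    show "\<not> has_clique E 3 ?B"
      using nbr[OF abc(2)] has_clique_mono[of E 3 ?B "{w \<in> S. E b w}"] by blast
    show "\<not> has_matching E p ?B"
      using no_matching_anticomplete[OF assms(2) abc(1,3,5)]
        has_matching_mono[of E p ?B "{w \<in> S. \<not> E a w \<and> \<not> E c w}"] by blast
  qed
  ultimately have "colorable E (?A \<union> ?B) (i + j)" by (rule colorable_Un)
  \<comment> \<open>Two adjacent vertices of \<open>?C\<close> would form a clique of order four
    with \<open>b\<close> and \<open>c\<close>.\<close>
  moreover have "colorable E ?C 1"
  proof (rule colorable_independent)
    fix x y assume "x \<in> ?C" "y \<in> ?C"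
    then show "\<not> E x y" using nbr[OF abc(2)] abc sym unfolding has_clique_3 by blast
  qed
  ultimately have "colorable E (?A \<union> ?B \<union> ?C) (i + j + 1)" by (rule colorable_Un)
  moreover have "colorable E ?D k"
    by (rule f) (use no_matching_anticomplete[OF assms(2) abc(1,2,4)]
      has_clique_mono[of E 4 ?D S] assms(1) in blast)+
  ultimately show ?thesis by (rule colorable_cover) auto
next
  case False
  then show ?thesis using g[OF False assms(2)] colorable_mono[of E S i "i + j + 1 + k"] by simp
qed

text \<open>If two colours suffice for the neighbourhood of \<open>a\<close>, three independent sets
  cover the rest. If not, it contains an induced pentagon, which forms a wheel with hub
  \<open>a\<close>.\<close>

lemma K4_free_2K2_free_colorable:
  assumes K4: "\<not> has_clique E 4 S" and M: "\<not> has_matching E 2 S"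
  shows "colorable E S 5"
proof (cases "has_clique E 3 S")
  case True
  then obtain a b c where abc: "a \<in> S" "b \<in> S" "c \<in> S" "E a b" "E a c" "E b c"
    unfolding has_clique_3 by blast
  let ?N = "{w \<in> S. E a w}"
  have nbr: "\<not> has_clique E 3 {w \<in> S. E x w}" if "x \<in> S" for x
    using no_clique_neighbours[of E 3 S x] K4 that by simp
  have far: "\<not> E x y" if "u \<in> S" "v \<in> S" "E u v" "x \<in> S" "y \<in> S"
    "\<not> E u x" "\<not> E v x" "\<not> E u y" "\<not> E v y" for u v x y
    using no_matching_anticomplete[of E 1 S u v] M that unfolding has_matching_1 Suc_1 by blast
  show ?thesis
  proof (cases "colorable E ?N 2")
    case True
    let ?C = "{w \<in> S. \<not> E a w \<and> E b w \<and> E c w}"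
    have "colorable E ?C 1"
    proof (rule colorable_independent)
      fix x y assume "x \<in> ?C" "y \<in> ?C"
      then show "\<not> E x y" using nbr[OF abc(2)] abc sym unfolding has_clique_3 by blast
    qed
    then have "colorable E (?N \<union> ?C) (2 + 1)" by (rule colorable_Un[OF True])
    \<comment> \<open>Each of these sets misses an edge of the triangle and is therefore
      independent; with \<open>?N\<close> and \<open>?C\<close> they exhaust
      \<open>S\<close>.\<close>
    moreover have "colorable E ({w \<in> S. \<not> E a w \<and> \<not> E b w} \<union> {w \<in> S. \<not> E a w \<and> \<not> E c w}) (1 + 1)"
      by (rule colorable_Un; rule colorable_independent) (use far abc in blast)+
    ultimately show ?thesis by (rule colorable_cover) auto
  next
    case False
    have MN: "\<not> has_matching E 2 ?N" using M has_matching_mono[of E 2 ?N S] by blast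
    have "has_matching E 1 ?N"
      using False colorable_no_edge[of E ?N] colorable_mono[of E ?N 1 2] by auto
    then obtain q0 q1 where q01: "q0 \<in> ?N" "q1 \<in> ?N" "E q0 q1"
      unfolding has_matching_1 by blast
    from pentagon_through_edge[OF nbr[OF abc(1)] MN False q01]
    obtain q2 q3 q4 where q: "q2 \<in> ?N" "q3 \<in> ?N" "q4 \<in> ?N" "E q1 q2" "E q2 q3" "E q3 q4" "E q4 q0"
      "\<not> E q0 q2" "\<not> E q0 q3" "\<not> E q1 q3" "\<not> E q1 q4" "\<not> E q2 q4" by blast
    have "E u v \<longleftrightarrow> E v u" for u v using sym by blast
    then have "embeds E [] [q0, q1, q2, q3, q4, a] wheel"
      using q q01 by (simp add: wheel_def mask_def)
    moreover have "set [q0, q1, q2, q3, q4, a] \<subseteq> S" using q q01 abc by auto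
    moreover have "\<not> has_clique E (Suc (Suc 2)) S" "\<not> has_matching E (Suc 1) S"
      using K4 M by (simp_all add: Suc_1 del: One_nat_def)
    ultimately show ?thesis using colorable_certificate wheel_certified by blast
  qed
next
  case False
  then show ?thesis using triangle_free_2K2_free_colorable[OF False M] colorable_mono[of E S 3 5] by simp
qed

text \<open>In a counterexample the vertices missing an edge are free of triangles and of induced
  \<open>2K\<^sub>2\<close> but not 2-colourable, so each edge among them lies in a pentagon among
  them. Combining such pentagons leads to subgraphs refuted by certificates.\<close>

lemma triangle_free_3K2_free_colorable:
  assumes K3: "\<not> has_clique E 3 S" and M: "\<not> has_matching E 3 S"
  shows "colorable E S 4"
proof (rule ccontr)
  assume nc: "\<not> colorable E S 4"
  have three: "Suc (Suc 1) = 3" "Suc 2 = 3" by simp_all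
  have comm: "E u v \<longleftrightarrow> E v u" for u v using sym by blast
  have triangle: False if "a \<in> S" "b \<in> S" "c \<in> S" "E a b" "E a c" "E b c" for a b c
    using K3 that unfolding has_clique_3 by blast
  have matching: False
    if "{a, b, c, d, e, f} \<subseteq> S" "E a b" "E c d" "E e f"
      "\<not> E a c" "\<not> E a d" "\<not> E a e" "\<not> E a f" "\<not> E b c" "\<not> E b d" "\<not> E b e" "\<not> E b f"
      "\<not> E c e" "\<not> E c f" "\<not> E d e" "\<not> E d f" for a b c d e f
  proof -
    have "has_matching E 1 {w \<in> {w \<in> S. \<not> E a w \<and> \<not> E b w}. \<not> E c w \<and> \<not> E d w}"
      unfolding has_matching_1 using that by blast
    from has_matching_SucI[OF _ _ that(3) this]
    have "has_matching E (Suc 1) {w \<in> S. \<not> E a w \<and> \<not> E b w}" using that by blast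
    from has_matching_SucI[OF _ _ that(2) this]
    have "has_matching E (Suc (Suc 1)) S" using that by blast
    then show False using M unfolding three by blast
  qed
  \<comment> \<open>Two colours here would give four on \<open>S\<close>, by
    \<open>triangle_free_step\<close>.\<close>
  have anti: "\<not> colorable E {w \<in> S. \<not> E a w \<and> \<not> E b w} 2" if "a \<in> S" "b \<in> S" for a b
    using triangle_free_step[OF K3 that, of 2] nc by auto
  have anti2: "\<not> has_clique E 3 {w \<in> S. \<not> E a w \<and> \<not> E b w}"
    "\<not> has_matching E 2 {w \<in> S. \<not> E a w \<and> \<not> E b w}" if "a \<in> S" "b \<in> S" "E a b" for a b
    using K3 has_clique_mono[of E 3 "{w \<in> S. \<not> E a w \<and> \<not> E b w}" S]
      no_matching_anticomplete[of E 2 S a b] M that by auto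
  have refuted: False
    if "certifies_from 1 2 4 [] [[]] N c" "embeds E [] hs N" "set hs \<subseteq> S" for N c hs
  proof -
    have "\<not> has_clique E (Suc (Suc 1)) S" "\<not> has_matching E (Suc 2) S"
      using K3 M unfolding three by blast+
    from colorable_certificate[OF this that] nc show False by blast
  qed
  \<comment> \<open>The pentagon through \<open>u v\<close> that misses \<open>q0 q1\<close> passes through a vertex that can replace \<open>q3\<close>.\<close>
  have step: "\<exists>x y z. {x, y, z} \<subseteq> S \<and> E v x \<and> E x y \<and> E y z \<and> E z u \<and> E y q2 \<and> E y q4
      \<and> \<not> E u x \<and> \<not> E u y \<and> \<not> E v y \<and> \<not> E v z \<and> \<not> E x z \<and> \<not> E y q0 \<and> \<not> E y q1
      \<and> \<not> E x q0 \<and> \<not> E x q1 \<and> \<not> E x q2 \<and> \<not> E x q4 \<and> \<not> E z q0 \<and> \<not> E z q1 \<and> \<not> E z q2 \<and> \<not> E z q4"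
    if emb: "embeds E [] [q0, q1, q2, q3, q4, u, v] pentagon_edge"
      and sub: "set [q0, q1, q2, q3, q4, u, v] \<subseteq> S" for q0 q1 q2 q3 q4 u v
  proof -
    have e: "E q0 q1" "E q1 q2" "E q2 q3" "E q3 q4" "E q4 q0" "E u v"
      "\<not> E q0 q2" "\<not> E q0 q3" "\<not> E q1 q3" "\<not> E q1 q4" "\<not> E q2 q4"
      "\<not> E u q0" "\<not> E u q1" "\<not> E u q2" "\<not> E u q3" "\<not> E u q4"
      "\<not> E v q0" "\<not> E v q1" "\<not> E v q2" "\<not> E v q3" "\<not> E v q4"
      using emb by (simp_all add: pentagon_edge_def mask_def comm)
    let ?A = "{w \<in> S. \<not> E q0 w \<and> \<not> E q1 w}"
    have q01: "q0 \<in> S" "q1 \<in> S" and uv: "u \<in> ?A" "v \<in> ?A" using sub e comm by auto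
    from pentagon_through_edge[OF anti2[OF q01 e(1)] anti[OF q01] uv e(6)]
    obtain x y z where xyz: "x \<in> ?A" "y \<in> ?A" "z \<in> ?A" "E v x" "E x y" "E y z" "E z u"
      "\<not> E u x" "\<not> E u y" "\<not> E v y" "\<not> E v z" "\<not> E x z" by blast
    \<comment> \<open>Otherwise \<open>y q3\<close>, \<open>q0 q1\<close> and \<open>u v\<close>
      would form an induced \<open>3K\<^sub>2\<close>.\<close>
    have y3: "\<not> E y q3"
      using matching[of y q3 q0 q1 u v] xyz e sub comm by auto
    \<comment> \<open>If just one of them held, \<open>u v\<close> would form an induced
      \<open>3K\<^sub>2\<close> with \<open>y q2\<close> and \<open>q4 q0\<close>, or with
      \<open>y q4\<close> and \<open>q1 q2\<close>.\<close>
    have "E y q2 \<longleftrightarrow> E y q4"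
      using matching[of y q2 q4 q0 u v] matching[of y q4 q1 q2 u v] xyz e sub comm by auto
    moreover have "E y q2"
    proof (rule ccontr)
      \<comment> \<open>Now \<open>y\<close> misses the whole first pentagon, so only the neighbours
        of \<open>x\<close> and \<open>z\<close> among \<open>q2\<close>, \<open>q3\<close>,
        \<open>q4\<close> are open.\<close>
      assume y2: "\<not> E y q2"
      then have y4: "\<not> E y q4" using calculation by blast
      let ?types = "[[2, 4], [2], [3], [4], []] :: nat list list"
      have type: "\<exists>a\<in>set ?types. (2 \<in> set a \<longleftrightarrow> E w q2) \<and> (3 \<in> set a \<longleftrightarrow> E w q3)
          \<and> (4 \<in> set a \<longleftrightarrow> E w q4) \<and> 0 \<notin> set a \<and> 1 \<notin> set a \<and> 5 \<notin> set a \<and> 6 \<notin> set a \<and> 7 \<notin> set a" if "w \<in> S" for w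
      proof -
        have "\<not> (E w q2 \<and> E w q3)" "\<not> (E w q3 \<and> E w q4)"
          using triangle[of w q2 q3] triangle[of w q3 q4] that sub e by auto
        then show ?thesis by (cases "E w q2"; cases "E w q3"; cases "E w q4") auto
      qed
      obtain a where a: "a \<in> set ?types" "2 \<in> set a \<longleftrightarrow> E x q2" "3 \<in> set a \<longleftrightarrow> E x q3"
        "4 \<in> set a \<longleftrightarrow> E x q4" "0 \<notin> set a" "1 \<notin> set a" "5 \<notin> set a" "6 \<notin> set a" "7 \<notin> set a"
        using type[of x] xyz by blast
      obtain b where b: "b \<in> set ?types" "2 \<in> set b \<longleftrightarrow> E z q2" "3 \<in> set b \<longleftrightarrow> E z q3"
        "4 \<in> set b \<longleftrightarrow> E z q4" "0 \<notin> set b" "1 \<notin> set b" "5 \<notin> set b" "6 \<notin> set b" "7 \<notin> set b"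
        using type[of z] xyz by blast
      have e': "\<not> E x q0" "\<not> E x q1" "\<not> E y q0" "\<not> E y q1" "\<not> E z q0" "\<not> E z q1"
        "E x v" "\<not> E x u" "\<not> E y u" "\<not> E y v" "E z u" "\<not> E z v" "E y x" "\<not> E z x"
        "E v u"
        using xyz comm e by auto
      \<comment> \<open>Both orientations of the second pentagon are embedded, since the table may
        list only one order of the pair.\<close>
      have ab: "embeds E [] [q0, q1, q2, q3, q4, u, v, x, z, y] (joined_pentagons a b)"
        "embeds E [] [q0, q1, q2, q3, q4, v, u, z, x, y] (joined_pentagons b a)"
        using emb a(2-) b(2-) e e' xyz(4-) y2 y3 y4
        by (simp_all add: joined_pentagons_def pentagon_edge_def mask_def numeral_eq_Suc)
      have "list_ex (\<lambda>(a', b', c). (a = a' \<and> b = b') \<or> (a = b' \<and> b = a')) joined_pentagons_table"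
        using joined_pentagons_complete a(1) b(1) unfolding list_all_iff by blast
      then obtain c where "(a, b, c) \<in> set joined_pentagons_table
          \<or> (b, a, c) \<in> set joined_pentagons_table"
        unfolding list_ex_iff by auto
      then have "certifies_from 1 2 4 [] [[]] (joined_pentagons a b) c
          \<or> certifies_from 1 2 4 [] [[]] (joined_pentagons b a) c"
        using joined_pentagons_certified unfolding list_all_iff by blast
      moreover have "set [q0, q1, q2, q3, q4, u, v, x, z, y] \<subseteq> S"
        "set [q0, q1, q2, q3, q4, v, u, z, x, y] \<subseteq> S" using sub xyz by auto
      ultimately show False using refuted ab by blast
    qed
    ultimately have y24: "E y q2" "E y q4" by auto
    have "\<not> E x q2" "\<not> E x q4" "\<not> E z q2" "\<not> E z q4"
      using triangle[of x y q2] triangle[of x y q4] triangle[of y z q2] triangle[of y z q4]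
        y24 xyz sub by auto
    then show ?thesis using y24 xyz comm by (intro exI[of _ x] exI[of _ y] exI[of _ z]) auto
  qed
  have "has_matching E 1 S"
    using nc colorable_no_edge[of E S] colorable_mono[of E S 1 4] by auto
  then obtain u v where uv: "u \<in> S" "v \<in> S" "E u v" unfolding has_matching_1 by blast
  let ?A = "{w \<in> S. \<not> E u w \<and> \<not> E v w}"
  have "has_matching E 1 ?A"
    using anti[OF uv(1,2)] colorable_no_edge[of E ?A] colorable_mono[of E ?A 1 2] by auto
  then obtain q0 q1 where q01: "q0 \<in> ?A" "q1 \<in> ?A" "E q0 q1" unfolding has_matching_1 by blast
  from pentagon_through_edge[OF anti2[OF uv] anti[OF uv(1,2)] q01]
  obtain q2 q3 q4 where q: "q2 \<in> ?A" "q3 \<in> ?A" "q4 \<in> ?A" "E q1 q2" "E q2 q3" "E q3 q4" "E q4 q0"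
    "\<not> E q0 q2" "\<not> E q0 q3" "\<not> E q1 q3" "\<not> E q1 q4" "\<not> E q2 q4" by blast
  have "embeds E [] [q0, q1, q2, q3, q4, u, v] pentagon_edge"
    using q q01 uv by (simp add: pentagon_edge_def mask_def comm)
  moreover have "set [q0, q1, q2, q3, q4, u, v] \<subseteq> S" using q q01 uv by auto
  ultimately obtain x y z where xyz: "{x, y, z} \<subseteq> S" "E v x" "E x y" "E y z" "E z u" "E y q2" "E y q4"
    "\<not> E u x" "\<not> E u y" "\<not> E v y" "\<not> E v z" "\<not> E x z" "\<not> E y q0" "\<not> E y q1"
    "\<not> E x q0" "\<not> E x q1" "\<not> E x q2" "\<not> E x q4" "\<not> E z q0" "\<not> E z q1" "\<not> E z q2" "\<not> E z q4"
    using step by blast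
  \<comment> \<open>With \<open>y\<close> in place of \<open>q3\<close>, the pentagon is rotated by
    one place, so that \<open>step\<close> now replaces \<open>q4\<close>.\<close>
  have "embeds E [] [q1, q2, y, q4, q0, u, v] pentagon_edge"
    using q q01 uv xyz by (simp add: pentagon_edge_def mask_def comm)
  moreover have "set [q1, q2, y, q4, q0, u, v] \<subseteq> S" using q q01 uv xyz by auto
  ultimately obtain x' y' z' where xyz': "{x', y', z'} \<subseteq> S" "E v x'" "E x' y'" "E y' z'" "E z' u"
    "E y' y" "E y' q0" "\<not> E u x'" "\<not> E u y'" "\<not> E v y'" "\<not> E v z'" "\<not> E x' z'"
    "\<not> E y' q1" "\<not> E y' q2" "\<not> E x' q1" "\<not> E x' q2" "\<not> E x' y" "\<not> E x' q0"
    "\<not> E z' q1" "\<not> E z' q2" "\<not> E z' y" "\<not> E z' q0"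
    using step by blast
  have new: "\<not> E x y'" "\<not> E z y'" "\<not> E x x'" "\<not> E z z'"
    using triangle[of y x y'] triangle[of y z y'] triangle[of v x x'] triangle[of u z z']
      xyz xyz' uv comm by auto
  \<comment> \<open>Only these two adjacencies remain open; in the numbering below \<open>z\<close>
    is 8 and \<open>x\<close> is 7.\<close>
  let ?a = "if E x' z then [4, 6, 8] else [4, 6 :: nat]"
  let ?b = "if E z' x then [4, 5, 7] else [4, 5 :: nat]"
  have "embeds E [] [q0, q1, q2, y, y', u, v, x, z, x', z'] (three_pentagons ?a ?b)"
    using q q01 uv xyz xyz' new
    by (simp add: three_pentagons_def pentagon_edge_def mask_def comm)
  moreover have "set [q0, q1, q2, y, y', u, v, x, z, x', z'] \<subseteq> S"
    using q q01 uv xyz xyz' by auto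
  moreover have "\<exists>c. (?a, ?b, c) \<in> set three_pentagons_table"
    by (auto simp: three_pentagons_table_def)
  then have "\<exists>c. certifies_from 1 2 4 [] [[]] (three_pentagons ?a ?b) c"
    using three_pentagons_certified unfolding list_all_iff by blast
  ultimately show False using refuted by blast
qed

section \<open>The inductions on \<open>p\<close>\<close>

lemma triangle_free_colorable:
  assumes "p \<ge> 3" "\<not> has_clique E 3 S" "\<not> has_matching E p S"
  shows "colorable E S (2 * p - 2)"
  using assms
proof (induction p arbitrary: S rule: nat_induct_at_least)
  case base
  then show ?case using triangle_free_3K2_free_colorable by simp
next
  case (Suc p)
  then have "colorable E S (2 * p - 2 + 2)"
    using triangle_free_colorable_Suc[of S p "2 * p - 2"] by blast
  moreover have "2 * p - 2 + 2 = 2 * Suc p - 2" using Suc.hyps by simp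
  ultimately show ?case by simp
qed

theorem K4_free_colorable:
  assumes "p \<ge> 3" "\<not> has_clique E 4 S" "\<not> has_matching E p S"
  shows "colorable E S (2 * p * p + 4 - 3 * p)"
  using assms
proof (induction p arbitrary: S rule: nat_induct_at_least)
  case base
  have "\<not> has_matching E (Suc 2) S" using base by simp
  \<comment> \<open>The sum 4 + 3 + 1 + 5 = 13 is the claimed bound for
    \<open>p = 3\<close>.\<close>
  from K4_free_colorable_Suc[OF base(1) this, of 4 3 5]
  show ?case
    using triangle_free_3K2_free_colorable triangle_free_2K2_free_colorable
      K4_free_2K2_free_colorable by simp
next
  case (Suc p)
  have col: "colorable E S ((2 * Suc p - 2) + (2 * p - 2) + 1 + (2 * p * p + 4 - 3 * p))"
    using Suc.prems
  proof (rule K4_free_colorable_Suc)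
    show "colorable E T (2 * Suc p - 2)"
      if "\<not> has_clique E 3 T" "\<not> has_matching E (Suc p) T" for T
      using triangle_free_colorable[of "Suc p" T] that Suc.hyps by simp
    show "colorable E T (2 * p - 2)" if "\<not> has_clique E 3 T" "\<not> has_matching E p T" for T
      using triangle_free_colorable[of p T] that Suc.hyps by simp
  qed (use Suc.IH in blast)
  \<comment> \<open>Naming the quadratic term makes the arithmetic linear;
    \<open>3 * p \<le> q\<close> keeps the natural subtraction exact.\<close>
  define q where "q = 2 * p * p"
  have "3 * p \<le> q" unfolding q_def using Suc.hyps by (simp add: mult_le_mono)
  moreover have "2 * Suc p * Suc p = q + 4 * p + 2" by (simp add: q_def)
  ultimately have "(2 * Suc p - 2) + (2 * p - 2) + 1 + (q + 4 - 3 * p) = 2 * Suc p * Suc p + 4 - 3 * Suc p"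
    using Suc.hyps by simp
  with col show ?case by (simp only: q_def)
qed

end

section \<open>Digraphs\<close>

lemma has_clique_imp_card:
  assumes "has_clique E n S" "\<And>u v. E u v \<Longrightarrow> E v u" "\<And>u. \<not> E u u"
  shows "\<exists>C\<subseteq>S. finite C \<and> card C = n \<and> (\<forall>u\<in>C. \<forall>v\<in>C. u \<noteq> v \<longrightarrow> E u v)"
  using assms(1)
proof (induction n arbitrary: S)
  case 0
  then show ?case by (intro exI[of _ "{}"]) auto
next
  case (Suc n)
  then obtain u where u: "u \<in> S" "has_clique E n {v \<in> S. E u v}" by auto
  from Suc.IH[OF u(2)] obtain C where C: "C \<subseteq> {v \<in> S. E u v}" "finite C" "card C = n"
    "\<forall>x\<in>C. \<forall>y\<in>C. x \<noteq> y \<longrightarrow> E x y" by blast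
  then have "u \<notin> C" using assms(3) by auto
  then show ?case
    using C u assms(2) by (intro exI[of _ "insert u C"]) auto
qed

text \<open>The arguments of \<open>f\<close> are the vertices of \<open>pK2 n\<close>, so that
  \<open>f\<close> can serve as an embedding.\<close>

lemma has_matching_imp_family:
  assumes "has_matching E n S" "\<And>u v. E u v \<Longrightarrow> E v u"
  shows "\<exists>f. (\<forall>i<n. \<forall>a. f (i, a) \<in> S) \<and> (\<forall>i<n. E (f (i, False)) (f (i, True))) \<and>
    (\<forall>i<n. \<forall>j<n. \<forall>a b. i \<noteq> j \<longrightarrow> \<not> E (f (i, a)) (f (j, b)))"
  using assms(1)
proof (induction n arbitrary: S)
  case (Suc n)
  then obtain u v where uv: "u \<in> S" "v \<in> S" "E u v"
    "has_matching E n {w \<in> S. \<not> E u w \<and> \<not> E v w}" by auto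
  from Suc.IH[OF uv(4)] obtain f where
    f: "\<forall>i<n. \<forall>a. f (i, a) \<in> {w \<in> S. \<not> E u w \<and> \<not> E v w}" "\<forall>i<n. E (f (i, False)) (f (i, True))"
    "\<forall>i<n. \<forall>j<n. \<forall>a b. i \<noteq> j \<longrightarrow> \<not> E (f (i, a)) (f (j, b))"
    by (elim exE conjE)
  \<comment> \<open>The edge chosen first receives the last index, so the edges from the induction
    hypothesis keep theirs.\<close>
  define g where "g = f((n, False) := u, (n, True) := v)"
  have g: "g (i, a) = (if i = n then if a then v else u else f (i, a))" for i a
    by (cases a) (auto simp: g_def)
  have "g (i, a) \<in> S" if "i < Suc n" for i a
    using that f(1) uv by (auto simp: g less_Suc_eq)
  moreover have "E (g (i, False)) (g (i, True))" if "i < Suc n" for i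
    using that f(2) uv by (auto simp: g less_Suc_eq)
  moreover have "\<not> E (g (i, a)) (g (j, b))" if "i < Suc n" "j < Suc n" "i \<noteq> j" for i j a b
  proof -
    have "\<not> E u (f (k, c)) \<and> \<not> E v (f (k, c))" if "k < n" for k c using f(1) that by simp
    moreover from this have "\<not> E (f (k, c)) u \<and> \<not> E (f (k, c)) v" if "k < n" for k c
      using assms(2) that by metis
    ultimately show ?thesis using f(3) that by (simp add: g less_Suc_eq) metis
  qed
  ultimately show ?case by (intro exI[of _ g]) simp
qed simp

text \<open>The family embeds \<open>pK2 p\<close>; its inverse is an isomorphism from the subgraph
  induced on the image.\<close>

lemma (in graph) has_matching_imp_not_pK2_free:
  assumes "has_matching (dominates G) p (verts G)"
  shows "\<not> pK2_free p G"
proof -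
  have sym: "v \<rightarrow>\<^bsub>G\<^esub> u" if "u \<rightarrow>\<^bsub>G\<^esub> v" for u v
    using that by (rule graph_symmetric)
  have irrefl: "\<not> u \<rightarrow>\<^bsub>G\<^esub> u" for u
    using no_loops by (auto simp: arcs_ends_conv)
  have "\<exists>f. (\<forall>i<p. \<forall>a. f (i, a) \<in> verts G) \<and> (\<forall>i<p. f (i, False) \<rightarrow>\<^bsub>G\<^esub> f (i, True)) \<and>
    (\<forall>i<p. \<forall>j<p. \<forall>a b. i \<noteq> j \<longrightarrow> \<not> f (i, a) \<rightarrow>\<^bsub>G\<^esub> f (j, b))"
    using assms by (rule has_matching_imp_family) (rule sym)
  then obtain f where
    f: "\<forall>i<p. \<forall>a. f (i, a) \<in> verts G" "\<forall>i<p. f (i, False) \<rightarrow>\<^bsub>G\<^esub> f (i, True)"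
    "\<forall>i<p. \<forall>j<p. \<forall>a b. i \<noteq> j \<longrightarrow> \<not> f (i, a) \<rightarrow>\<^bsub>G\<^esub> f (j, b)"
    by (elim exE conjE)
  let ?P = "{..<p} \<times> (UNIV :: bool set)"
  have adj: "f (i, a) \<rightarrow>\<^bsub>G\<^esub> f (j, b) \<longleftrightarrow> i = j \<and> a \<noteq> b" if "i < p" "j < p" for i j a b
    using f(2,3) sym[of "f (i, False)" "f (i, True)"] that irrefl
    by (cases "i = j"; cases a; cases b) simp_all
  have inj: "inj_on f ?P"
  proof (rule inj_onI, clarsimp)
    fix i j a b assume ij: "i < p" "j < p" "f (i, a) = f (j, b)"
    \<comment> \<open>If two images coincide, they share the matching partner
      \<open>f (i, \<not> a)\<close>, and \<open>adj\<close> forces equal arguments.\<close>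
    have "f (i, a) \<rightarrow>\<^bsub>G\<^esub> f (i, \<not> a)" using adj[OF ij(1,1), of a "\<not> a"] by simp
    then have "f (j, b) \<rightarrow>\<^bsub>G\<^esub> f (i, \<not> a)" using ij(3) by simp
    then show "i = j \<and> a = b" using adj[OF ij(2,1), of b "\<not> a"] by auto
  qed
  define h where "h = the_inv_into ?P f"
  have h: "h (f (i, a)) = (i, a)" if "i < p" for i a
    using the_inv_into_f_f[OF inj, of "(i, a)"] that by (simp add: h_def)
  define H where "H = G \<restriction> (f ` ?P)"
  have ind: "induced_subgraph H G"
    unfolding H_def by (rule induced_induce) (use f(1) in auto)
  \<comment> \<open>The arcs of \<open>pK2 p\<close> are pairs of vertices, so an arc goes to the
    pair of images of its ends.\<close>
  define iso where "iso = \<lparr>iso_verts = h, iso_arcs = (\<lambda>e. (h (tail G e), h (head G e))),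
    iso_head = snd, iso_tail = fst\<rparr>"
  have injh: "inj_on h (f ` ?P)"
    by (auto simp: inj_on_def h)
  have "pre_digraph.digraph_isomorphism H iso"
    unfolding pre_digraph.digraph_isomorphism_def
  proof (intro conjI ballI)
    show "wf_digraph H" unfolding H_def by (rule wellformed_induce_subgraph)
    show "inj_on (iso_verts iso) (verts H)" using injh by (simp add: iso_def H_def)
    show "inj_on (iso_arcs iso) (arcs H)"
    proof (rule inj_onI)
      fix e e' assume e: "e \<in> arcs H" "e' \<in> arcs H" "iso_arcs iso e = iso_arcs iso e'"
      then have "tail G e = tail G e'" "head G e = head G e'"
        using injh by (auto simp: H_def iso_def dest: inj_onD)
      then show "e = e'" using e no_multi_arcs by (simp add: H_def arc_to_ends_def)
    qed
  qed (simp_all add: iso_def H_def)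
  moreover have "pK2 p = app_iso iso H"
  proof -
    have "h ` f ` ?P = ?P" by (force simp: h image_iff)
    moreover have "(\<lambda>e. (h (tail G e), h (head G e))) ` arcs H
        = {((i, a), (i, b)) | i a b. i < p \<and> a \<noteq> b}" (is "?L = ?R")
    proof (intro equalityI subsetI)
      fix x assume "x \<in> ?L"
      then obtain e i a j b where e: "e \<in> arcs G" "tail G e = f (i, a)" "head G e = f (j, b)"
        "i < p" "j < p" "x = (h (tail G e), h (head G e))"
        by (auto simp: H_def)
      have "f (i, a) \<rightarrow>\<^bsub>G\<^esub> f (j, b)" using e(1-3) by (force simp: arcs_ends_conv)
      then show "x \<in> ?R" using adj[OF e(4,5), of a b] e h by auto
    next
      fix x assume "x \<in> ?R"
      then obtain i a b where x: "x = ((i, a), (i, b))" "i < p" "a \<noteq> b" by auto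
      then have "f (i, a) \<rightarrow>\<^bsub>G\<^esub> f (i, b)" using adj by simp
      then obtain e where e: "e \<in> arcs G" "tail G e = f (i, a)" "head G e = f (i, b)"
        by (auto simp: arcs_ends_conv)
      then have "e \<in> arcs H" using x by (auto simp: H_def)
      then show "x \<in> ?L" using e x h by (force intro!: image_eqI[of _ _ e])
    qed
    ultimately show ?thesis by (simp add: pK2_def with_proj_def app_iso_def iso_def H_def)
  qed
  ultimately have "digraph_iso H (pK2 p)" unfolding digraph_iso_def by blast
  with ind show ?thesis unfolding pK2_free_def by blast
qed

theorem theorem3p2:
  fixes p :: nat and G :: "('a, 'b) pre_digraph"
  assumes "p \<ge> 3"
    and "graph G"
    and "pK2_free p G"
    and "clique_number G = 3"
  shows "int (chromatic_number G) \<le> 2 * (int p)\<^sup>2 - 3 * int p + 4"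
proof -
  interpret graph G by fact
  let ?E = "dominates G"
  interpret simple_relation ?E
  proof
    show "v \<rightarrow>\<^bsub>G\<^esub> u" if "u \<rightarrow>\<^bsub>G\<^esub> v" for u v using that by (rule graph_symmetric)
    show "\<not> u \<rightarrow>\<^bsub>G\<^esub> u" for u using no_loops by (auto simp: arcs_ends_conv)
  qed
  have "\<not> has_clique ?E 4 (verts G)"
  proof
    assume "has_clique ?E 4 (verts G)"
    then have "\<exists>C\<subseteq>verts G. finite C \<and> card C = 4 \<and> (\<forall>u\<in>C. \<forall>v\<in>C. u \<noteq> v \<longrightarrow> u \<rightarrow>\<^bsub>G\<^esub> v)"
      by (rule has_clique_imp_card) (use sym irrefl in blast)+
    then obtain C where "is_clique G C" "card C = 4" unfolding is_clique_def by blast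
    then have "4 \<in> {card C | C. is_clique G C}" by auto
    \<comment> \<open>Finiteness makes \<open>Max\<close> an upper bound of the set.\<close>
    moreover have "finite {card C | C. is_clique G C}"
      by (rule finite_subset[of _ "card ` Pow (verts G)"]) (auto simp: is_clique_def)
    ultimately have "4 \<le> clique_number G" unfolding clique_number_def by (rule Max_ge[rotated])
    then show False using assms(4) by simp
  qed
  moreover have "\<not> has_matching ?E p (verts G)"
    using has_matching_imp_not_pK2_free assms(3) by blast
  ultimately have "colorable ?E (verts G) (2 * p * p + 4 - 3 * p)"
    using K4_free_colorable assms(1) by blast
  then have "chromatic_number G \<le> 2 * p * p + 4 - 3 * p"
    unfolding chromatic_number_def colorable_def proper_coloring_def by (intro Least_le)
  \<comment> \<open>This rules out truncated subtraction before passing to the integers.\<close>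
  moreover have "3 * p \<le> 2 * p * p" using assms(1) by (simp add: mult_le_mono)
  ultimately have "chromatic_number G + 3 * p \<le> 2 * p * p + 4" by linarith
  then have "int (chromatic_number G + 3 * p) \<le> int (2 * p * p + 4)" by (simp only: of_nat_le_iff)
  then show ?thesis by (simp add: power2_eq_square)
qed

end
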